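(* Let $\mathcal H$ be a real Hilbert space and let $f:\mathcal H\to\mathbb R$ be a $\mathcal C^1$ convex function whose gradient is $L$-Lipschitz continuous and such that $\operatorname{argmin}_{\mathcal H} f\neq\emptyset$; let $x^\star\in\operatorname{argmin}_{\mathcal H} f$. Let $(y_k)_{k\in\mathbb N}$ be the sequence generated by (RAG$_\alpha$) with step size $s=h^2$, $h>0$, where $\alpha\ge3$ and $sL<1$. Define $$E_k=h^2(k+2-\alpha)(k+1)\bigl(f(y_k)-f(x^\star)\bigr)+\frac12\|z_k\|^2,$$ $$z_k=(\alpha-1)(y_{k+1}-x^\star)+h(k+2-\alpha)\bigl(v_k+h\nabla f(y_k)\bigr),\qquad v_k=\frac1h(y_{k+1}-y_k).$$ Then the sequence $(E_k)_{k\in\mathbb N}$ is non-increasing, and the following convergence rate is satisfied: $$\sum_k k^2\|\nabla f(y_k)\|^2<+\infty .$$ In addition, when $\alpha>3$, $$\sum_k k\bigl(f(y_k)-f(x^\star)\bigr)<+\infty .$$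
   Context: The Ravine accelerated gradient algorithm (RAG$_\alpha$) with step size $s>0$ generates sequences satisfying $$w_k=y_k-s\nabla f(y_k),\qquad y_{k+1}=w_k+\left(1-\tfrac{\alpha}{k+1}\right)(w_k-w_{k-1}).$$
   Formalization: E_k is shown non-increasing only over indices k ≥ α−2; for all k the claim is false: with α=3, f(x)=x²/2 on the reals, h=1/2, y_0=1, y_1=0 one gets E_0=5/32 < E_1=9/32. *)

theory Defs
  imports "HOL-Analysis.Analysis"
begin

text \<open>
  Ravine accelerated gradient algorithm. Here \<open>g\<close> stands for the gradient of the objective.
  The recursion for \<open>y (k + 1)\<close> refers to \<open>w (k - 1)\<close>, so it is imposed for \<open>k \<ge> 1\<close> and
  the initial points \<open>y 0\<close> and \<open>y 1\<close> are unconstrained. (An extra starting point \<open>w\<^sub>-\<^sub>1\<close> with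
  the recursion imposed at \<open>k = 0\<close> too would, for \<open>\<alpha> \<noteq> 1\<close>, yield the same sequences, because
  \<open>w\<^sub>-\<^sub>1\<close> can be chosen to give any \<open>y 1\<close>.)
\<close>
definition RAG ::
  "real \<Rightarrow> real \<Rightarrow> ('a::real_vector \<Rightarrow> 'a) \<Rightarrow> (nat \<Rightarrow> 'a) \<Rightarrow> (nat \<Rightarrow> 'a) \<Rightarrow> bool" where
  "RAG \<alpha> s g w y \<longleftrightarrow>
     (\<forall>k. w k = y k - s *\<^sub>R g (y k)) \<and>
     (\<forall>k\<ge>1. y (k + 1) = w k + (1 - \<alpha> / (real k + 1)) *\<^sub>R (w k - w (k - 1)))"

definition rag_v :: "real \<Rightarrow> (nat \<Rightarrow> 'a::real_vector) \<Rightarrow> nat \<Rightarrow> 'a" where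
  "rag_v h y k = (1 / h) *\<^sub>R (y (k + 1) - y k)"

definition rag_z ::
  "real \<Rightarrow> real \<Rightarrow> ('a::real_vector \<Rightarrow> 'a) \<Rightarrow> 'a \<Rightarrow> (nat \<Rightarrow> 'a) \<Rightarrow> nat \<Rightarrow> 'a" where
  "rag_z \<alpha> h g x y k =
     (\<alpha> - 1) *\<^sub>R (y (k + 1) - x) + (h * (real k + 2 - \<alpha>)) *\<^sub>R (rag_v h y k + h *\<^sub>R g (y k))"

text \<open>
  For \<open>k < \<alpha> - 2\<close> the coefficient of \<open>f (y k) - f x\<close> is negative and the energy may increase
  from \<open>k\<close> to \<open>k + 1\<close>: on the reals with \<open>f x = x\<^sup>2 / 2\<close>, \<open>\<alpha> = 3\<close>, \<open>h = 1 / 2\<close>, \<open>y 0 = 1\<close>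
  and \<open>y 1 = 0\<close>, its values at \<open>0\<close> and \<open>1\<close> are \<open>5 / 32\<close> and \<open>9 / 32\<close>. Monotonicity
  is therefore a statement about the indices with \<open>k + 2 - \<alpha> \<ge> 0\<close>.
\<close>
definition rag_E ::
  "real \<Rightarrow> real \<Rightarrow> ('a::real_normed_vector \<Rightarrow> real) \<Rightarrow> ('a \<Rightarrow> 'a) \<Rightarrow> 'a \<Rightarrow> (nat \<Rightarrow> 'a) \<Rightarrow> nat \<Rightarrow> real" where
  "rag_E \<alpha> h f g x y k =
     h\<^sup>2 * (real k + 2 - \<alpha>) * (real k + 1) * (f (y k) - f x) + 1 / 2 * (norm (rag_z \<alpha> h g x y k))\<^sup>2"

end

theory Submission
  imports Defs
begin

text \<open>
  Write \<open>s = h\<^sup>2\<close>, \<open>g = gradf\<close> and \<open>F k = f (y k) - f xstar\<close>. The algorithm alternates gradient steps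
  \<open>w k = y k - s g (y k)\<close> with an extrapolation, and the vector \<open>z k\<close> is chosen so that the
  extrapolation drops out of its increments: the recursion turns into
  \<open>z (k + 1) - z k = - (k + 1) s g (y (k + 1))\<close>, where moreover \<open>z (k + 1)\<close> is the combination
  \<open>(k + 2 - \<alpha>) (w (k + 1) - w k) + (\<alpha> - 1) (w (k + 1) - xstar)\<close> of differences of points reached by
  gradient steps (\<open>xstar\<close> is one of them, being its own gradient step).

  Expanding the square of \<open>z k\<close> therefore produces inner products of \<open>g u\<close> with
  \<open>(u - s g u) - (v - s g v)\<close>, for \<open>u = y (k + 1)\<close> and \<open>v\<close> either \<open>y k\<close> or \<open>xstar\<close>. Convexity and
  \<open>L\<close>-smoothness bound such a product below by \<open>f u - f v\<close>, up to an error of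
  \<open>(s\<^sup>2 L / 2) \<parallel>g u\<parallel>\<^sup>2\<close> (lemma \<open>gradient_step_inequality\<close>). The two weights add up to \<open>k + 1\<close>, so that
  the errors add up to \<open>s L\<close> times the term \<open>((k + 1)\<^sup>2 s\<^sup>2 / 2) \<parallel>g u\<parallel>\<^sup>2\<close> which the square of the
  increment contributes with the favourable sign. Since \<open>s L < 1\<close>, a proportion \<open>1 - s L\<close> of that
  term survives. The values of \<open>f\<close> at \<open>y k\<close> cancel, and those at \<open>y (k + 1)\<close> are left with the
  coefficient \<open>- s ((\<alpha> - 3) k + 2 \<alpha> - 5)\<close>. Once \<open>k + 2 \<ge> \<alpha>\<close>, the energy thus decreases by at least
  the sum of two nonnegative terms (lemma \<open>rag_E_decrease\<close>), and since it is itself nonnegative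
  from there on, telescoping makes both summable. The second of these terms grows like \<open>k F (k + 1)\<close>
  exactly when \<open>\<alpha> > 3\<close>; for \<open>\<alpha> = 3\<close> it only controls \<open>F (k + 1)\<close>.
\<close>

section \<open>Smooth convex functions\<close>

lemma has_real_derivative_along_line:
  fixes f :: "'a::real_inner \<Rightarrow> real"
  assumes "GDERIV f (a + t *\<^sub>R d) :> D"
  shows "((\<lambda>t. f (a + t *\<^sub>R d)) has_real_derivative inner D d) (at t)"
proof -
  have "((\<lambda>t. a + t *\<^sub>R d) has_derivative (\<lambda>r. r *\<^sub>R d)) (at t)"
    by (auto intro!: derivative_eq_intros)
  from has_derivative_compose[OF this assms[unfolded gderiv_def]]
  have "((\<lambda>t. f (a + t *\<^sub>R d)) has_derivative (\<lambda>r. r * inner d D)) (at t)"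
    by simp
  then show ?thesis
    by (simp add: has_field_derivative_def inner_commute mult.commute[of _ "inner D d"])
qed

lemma convex_on_above_gradient:
  fixes f :: "'a::real_inner \<Rightarrow> real"
  assumes convex: "convex_on UNIV f" and grad: "GDERIV f u :> D"
  shows "f u + inner D (v - u) \<le> f v"
proof -
  let ?\<phi> = "\<lambda>t::real. f (u + t *\<^sub>R (v - u))"
  have "convex_on UNIV ?\<phi>"
  proof (rule convex_onI)
    fix t a b :: real
    assume "0 < t" "t < 1"
    have "u + ((1 - t) *\<^sub>R a + t *\<^sub>R b) *\<^sub>R (v - u)
        = (1 - t) *\<^sub>R (u + a *\<^sub>R (v - u)) + t *\<^sub>R (u + b *\<^sub>R (v - u))"
      by (simp add: algebra_simps)
    with \<open>0 < t\<close> \<open>t < 1\<close> show "?\<phi> ((1 - t) *\<^sub>R a + t *\<^sub>R b) \<le> (1 - t) * ?\<phi> a + t * ?\<phi> b"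
      using convex_onD[OF convex, of t] by auto
  qed auto
  moreover have "(?\<phi> has_real_derivative inner D (v - u)) (at 0)"
    using grad by (intro has_real_derivative_along_line) simp
  ultimately have "inner D (v - u) * (1 - 0) \<le> ?\<phi> 1 - ?\<phi> 0"
    by (intro convex_on_imp_above_tangent[where A = UNIV]) auto
  then show ?thesis
    by simp
qed

text \<open>
  The descent lemma: along the segment from \<open>u\<close> to \<open>v\<close>, the slope of \<open>f\<close> exceeds its initial value
  by at most \<open>L t \<parallel>v - u\<parallel>\<^sup>2\<close> at parameter \<open>t\<close>. Comparing monotonicity instead of integrating this
  bound avoids any appeal to integrals.
\<close>
lemma lipschitz_gradient_upper_bound:
  fixes f :: "'a::real_inner \<Rightarrow> real"
  assumes grad: "\<And>x. GDERIV f x :> g x" and lip: "L-lipschitz_on UNIV g"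
  shows "f v \<le> f u + inner (g u) (v - u) + L / 2 * (norm (v - u))\<^sup>2"
proof -
  let ?d = "v - u"
  define \<psi> where "\<psi> t = f (u + t *\<^sub>R ?d) - t * inner (g u) ?d - t\<^sup>2 * (L / 2 * (norm ?d)\<^sup>2)" for t
  have deriv: "(\<psi> has_real_derivative
      inner (g (u + t *\<^sub>R ?d)) ?d - inner (g u) ?d - 2 * t * (L / 2 * (norm ?d)\<^sup>2)) (at t)" for t
    unfolding \<psi>_def
    by (rule derivative_eq_intros has_real_derivative_along_line[OF grad] refl | simp)+
  have slope: "inner (g (u + t *\<^sub>R ?d)) ?d - inner (g u) ?d - 2 * t * (L / 2 * (norm ?d)\<^sup>2) \<le> 0"
    if "0 \<le> t" for t
  proof -
    have "inner (g (u + t *\<^sub>R ?d)) ?d - inner (g u) ?d = inner (g (u + t *\<^sub>R ?d) - g u) ?d"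
      by (simp add: inner_diff_left)
    also have "\<dots> \<le> norm (g (u + t *\<^sub>R ?d) - g u) * norm ?d"
      by (rule norm_cauchy_schwarz)
    also have "\<dots> \<le> (L * norm (t *\<^sub>R ?d)) * norm ?d"
      using lipschitz_onD[OF lip, of "u + t *\<^sub>R ?d" u]
      by (intro mult_right_mono) (auto simp: dist_norm)
    also have "\<dots> = 2 * t * (L / 2 * (norm ?d)\<^sup>2)"
      using that by (simp add: power2_eq_square)
    finally show ?thesis
      by simp
  qed
  have "\<psi> 1 \<le> \<psi> 0"
    using deriv slope by (intro DERIV_nonpos_imp_nonincreasing[of 0 1 \<psi>]) (simp, blast)
  then show ?thesis
    by (simp add: \<psi>_def)
qed

text \<open>
  A gradient step of length \<open>1 / L\<close> from \<open>xmin\<close> would lower \<open>f\<close> by at least \<open>\<parallel>g xmin\<parallel>\<^sup>2 / (2 L)\<close>.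
\<close>
lemma gradient_zero_at_minimizer:
  fixes f :: "'a::real_inner \<Rightarrow> real"
  assumes grad: "\<And>x. GDERIV f x :> g x" and lip: "L-lipschitz_on UNIV g" and "L > 0"
    and min: "\<And>x. f xmin \<le> f x"
  shows "g xmin = 0"
proof -
  let ?u = "xmin - (1 / L) *\<^sub>R g xmin"
  have "f xmin \<le> f ?u"
    by (rule min)
  also have "\<dots> \<le> f xmin + inner (g xmin) (?u - xmin) + L / 2 * (norm (?u - xmin))\<^sup>2"
    using grad lip by (rule lipschitz_gradient_upper_bound)
  also have "\<dots> = f xmin - (norm (g xmin))\<^sup>2 / (2 * L)"
    using \<open>L > 0\<close> by (simp add: dot_square_norm power_divide power2_eq_square[of L] field_simps)
  finally show ?thesis
    using \<open>L > 0\<close> by (simp add: field_simps)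
qed

text \<open>
  The tangent bound at \<open>u\<close> and the descent lemma at \<open>v\<close> are compared at the point that minimises the
  quadratic upper bound minus the tangent, which is \<open>v - (g v - g u) / L\<close>.
\<close>
lemma convex_smooth_lower_bound:
  fixes f :: "'a::real_inner \<Rightarrow> real"
  assumes grad: "\<And>x. GDERIV f x :> g x" and convex: "convex_on UNIV f"
    and lip: "L-lipschitz_on UNIV g" and "L > 0"
  shows "f u + inner (g u) (v - u) + (norm (g u - g v))\<^sup>2 / (2 * L) \<le> f v"
proof -
  define d where "d = g v - g u"
  define p where "p = v - (1 / L) *\<^sub>R d"
  have "f u + inner (g u) (p - u) \<le> f p"
    using convex grad by (rule convex_on_above_gradient)
  also have "\<dots> \<le> f v + inner (g v) (p - v) + L / 2 * (norm (p - v))\<^sup>2"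
    using grad lip by (rule lipschitz_gradient_upper_bound)
  finally have main: "f u + inner (g u) (p - u)
      \<le> f v + inner (g v) (p - v) + L / 2 * (norm (p - v))\<^sup>2" .
  have "inner (g v) (p - v) = - inner (g u) d / L - (norm d)\<^sup>2 / L"
    using \<open>L > 0\<close>
    by (simp add: p_def d_def power2_norm_eq_inner inner_diff_left inner_diff_right
        inner_commute field_simps)
  moreover have "inner (g u) (p - u) = inner (g u) (v - u) - inner (g u) d / L"
    by (simp add: p_def inner_diff_right)
  moreover have "L / 2 * (norm (p - v))\<^sup>2 = (norm d)\<^sup>2 / (2 * L)"
    using \<open>L > 0\<close> by (simp add: p_def power_mult_distrib power2_eq_square field_simps)
  moreover have "(norm d)\<^sup>2 / L = 2 * ((norm d)\<^sup>2 / (2 * L))"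
    by simp
  ultimately have "f u + inner (g u) (v - u) + (norm d)\<^sup>2 / (2 * L) \<le> f v"
    using main by linarith
  then show ?thesis
    by (simp add: d_def norm_minus_commute)
qed

text \<open>
  The convexity inequality with both points replaced by their gradient steps. The change
  \<open>- s \<langle>g u, g u - g v\<rangle>\<close> of the inner product is absorbed, by Young's inequality, into the term
  \<open>\<parallel>g u - g v\<parallel>\<^sup>2 / (2 L)\<close> gained from smoothness, at the price of \<open>(s\<^sup>2 L / 2) \<parallel>g u\<parallel>\<^sup>2\<close>.
\<close>
lemma gradient_step_inequality:
  fixes f :: "'a::real_inner \<Rightarrow> real"
  assumes grad: "\<And>x. GDERIV f x :> g x" and convex: "convex_on UNIV f"
    and lip: "L-lipschitz_on UNIV g" and "L > 0"
  shows "f u - f v - s\<^sup>2 * L / 2 * (norm (g u))\<^sup>2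
       \<le> inner (g u) ((u - s *\<^sub>R g u) - (v - s *\<^sub>R g v))"
proof -
  define d where "d = g u - g v"
  have "0 \<le> (norm (d - (s * L) *\<^sub>R g u))\<^sup>2 / (2 * L)"
    using \<open>L > 0\<close> by simp
  also have "\<dots> = (norm d)\<^sup>2 / (2 * L) - s * inner (g u) d + s\<^sup>2 * L / 2 * (norm (g u))\<^sup>2"
    using \<open>L > 0\<close> unfolding power2_norm_eq_inner
    by (simp add: inner_diff_left inner_diff_right inner_commute power2_eq_square field_simps)
  finally have young: "s * inner (g u) d - s\<^sup>2 * L / 2 * (norm (g u))\<^sup>2 \<le> (norm d)\<^sup>2 / (2 * L)"
    by simp
  have "f u + inner (g u) (v - u) + (norm d)\<^sup>2 / (2 * L) \<le> f v"
    unfolding d_def using assms by (rule convex_smooth_lower_bound)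
  moreover have "inner (g u) ((u - s *\<^sub>R g u) - (v - s *\<^sub>R g v))
      = - inner (g u) (v - u) - s * inner (g u) d"
    by (simp add: d_def inner_diff_right algebra_simps)
  ultimately show ?thesis
    using young by linarith
qed

section \<open>The energy along the algorithm\<close>

lemma RAG_gradient_step: "RAG \<alpha> s g w y \<Longrightarrow> w k = y k - s *\<^sub>R g (y k)"
  by (simp add: RAG_def)

lemma RAG_extrapolation:
  assumes "RAG \<alpha> s g w y"
  shows "y (k + 2) = w (k + 1) + (1 - \<alpha> / (real k + 2)) *\<^sub>R (w (k + 1) - w k)"
proof -
  have "y ((k + 1) + 1)
      = w (k + 1) + (1 - \<alpha> / (real (k + 1) + 1)) *\<^sub>R (w (k + 1) - w (k + 1 - 1))"
    using assms unfolding RAG_def by (metis le_add2)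
  then show ?thesis
    by (simp add: add.commute)
qed

lemma rag_z_eq:
  assumes rag: "RAG \<alpha> (h\<^sup>2) g w y" and "h \<noteq> 0"
  shows "rag_z \<alpha> h g x y k
       = (\<alpha> - 1) *\<^sub>R (y (k + 1) - x) + (real k + 2 - \<alpha>) *\<^sub>R (y (k + 1) - w k)"
proof -
  have "h *\<^sub>R (rag_v h y k + h *\<^sub>R g (y k)) = y (k + 1) - w k"
    using \<open>h \<noteq> 0\<close>
    by (simp add: rag_v_def RAG_gradient_step[OF rag] scaleR_add_right power2_eq_square)
  then have "(h * (real k + 2 - \<alpha>)) *\<^sub>R (rag_v h y k + h *\<^sub>R g (y k))
      = (real k + 2 - \<alpha>) *\<^sub>R (y (k + 1) - w k)"
    by (metis mult.commute scaleR_scaleR)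
  then show ?thesis
    by (simp add: rag_z_def)
qed

text \<open>
  Clearing the denominator \<open>k + 2\<close> of the extrapolation step removes \<open>y (k + 2)\<close> from
  \<open>z (k + 1)\<close>.
\<close>
lemma rag_z_Suc:
  assumes rag: "RAG \<alpha> (h\<^sup>2) g w y" and "h \<noteq> 0"
  shows "rag_z \<alpha> h g x y (k + 1)
       = (real k + 2 - \<alpha>) *\<^sub>R (w (k + 1) - w k) + (\<alpha> - 1) *\<^sub>R (w (k + 1) - x)"
proof -
  define q where "q = y (k + 2) - w (k + 1)"
  have "q = (1 - \<alpha> / (real k + 2)) *\<^sub>R (w (k + 1) - w k)"
    unfolding q_def RAG_extrapolation[OF rag] by (rule add_diff_cancel_left')
  then have "(real k + 2) *\<^sub>R q = ((real k + 2) * (1 - \<alpha> / (real k + 2))) *\<^sub>R (w (k + 1) - w k)"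
    by simp
  also have "(real k + 2) * (1 - \<alpha> / (real k + 2)) = real k + 2 - \<alpha>"
    by (simp add: field_simps)
  finally have q: "(real k + 2) *\<^sub>R q = (real k + 2 - \<alpha>) *\<^sub>R (w (k + 1) - w k)" .
  have "rag_z \<alpha> h g x y (k + 1)
      = (\<alpha> - 1) *\<^sub>R (q + (w (k + 1) - x)) + (real k + 3 - \<alpha>) *\<^sub>R q"
    unfolding rag_z_eq[OF assms] by (simp add: q_def algebra_simps)
  also have "\<dots> = (real k + 2) *\<^sub>R q + (\<alpha> - 1) *\<^sub>R (w (k + 1) - x)"
  proof -
    have "(\<alpha> - 1) *\<^sub>R q + (real k + 3 - \<alpha>) *\<^sub>R q = (real k + 2) *\<^sub>R q"
      by (simp flip: scaleR_add_left)
    then show ?thesis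
      by (simp add: scaleR_add_right)
  qed
  finally show ?thesis
    by (simp only: q)
qed

lemma rag_z_increment:
  assumes rag: "RAG \<alpha> (h\<^sup>2) g w y" and "h \<noteq> 0"
  shows "rag_z \<alpha> h g x y k
       = rag_z \<alpha> h g x y (k + 1) + ((real k + 1) * h\<^sup>2) *\<^sub>R g (y (k + 1))"
proof -
  define u t where "u = g (y (k + 1))" and "t = real k + 2 - \<alpha>"
  have y: "y (k + 1) = w (k + 1) + h\<^sup>2 *\<^sub>R u"
    by (simp add: RAG_gradient_step[OF rag] u_def)
  have "rag_z \<alpha> h g x y k = (\<alpha> - 1) *\<^sub>R (w (k + 1) + h\<^sup>2 *\<^sub>R u - x)
      + t *\<^sub>R (w (k + 1) + h\<^sup>2 *\<^sub>R u - w k)"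
    unfolding rag_z_eq[OF assms] y t_def ..
  also have "\<dots> = t *\<^sub>R (w (k + 1) - w k) + (\<alpha> - 1) *\<^sub>R (w (k + 1) - x)
      + ((t + (\<alpha> - 1)) * h\<^sup>2) *\<^sub>R u"
    by (simp add: algebra_simps)
  also have "t + (\<alpha> - 1) = real k + 1"
    by (simp add: t_def)
  finally show ?thesis
    unfolding rag_z_Suc[OF assms] t_def u_def .
qed

text \<open>
  The condition on \<open>k\<close> makes both weights in \<open>z (k + 1)\<close> nonnegative, so that
  \<open>gradient_step_inequality\<close> may be applied to each of the two differences.
\<close>
lemma rag_E_decrease:
  fixes f :: "'a::real_inner \<Rightarrow> real"
  assumes grad: "\<And>x. GDERIV f x :> g x" and convex: "convex_on UNIV f"
    and lip: "L-lipschitz_on UNIV g" and "L > 0"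
    and min: "\<And>x. f xmin \<le> f x"
    and rag: "RAG \<alpha> (h\<^sup>2) g w y" and "h \<noteq> 0" and "\<alpha> \<ge> 1" and k: "real k + 2 - \<alpha> \<ge> 0"
  shows "rag_E \<alpha> h f g xmin y (k + 1)
           + h\<^sup>2 * ((\<alpha> - 3) * real k + 2 * \<alpha> - 5) * (f (y (k + 1)) - f xmin)
           + (1 - h\<^sup>2 * L) * (h\<^sup>2)\<^sup>2 / 2 * ((real k + 1)\<^sup>2 * (norm (g (y (k + 1))))\<^sup>2)
       \<le> rag_E \<alpha> h f g xmin y k"
proof -
  define s where "s = h\<^sup>2"
  define n t where "n = real k + 1" and "t = real k + 2 - \<alpha>"
  define F F' where "F = f (y k) - f xmin" and "F' = f (y (k + 1)) - f xmin"
  define g' where "g' = g (y (k + 1))"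
  define A where "A = (norm g')\<^sup>2"
  define z z' where "z = rag_z \<alpha> h g xmin y k" and "z' = rag_z \<alpha> h g xmin y (k + 1)"
  define err where "err = s\<^sup>2 * L / 2 * A"
  have w: "w j = y j - s *\<^sub>R g (y j)" for j
    unfolding s_def by (rule RAG_gradient_step[OF rag])
  have step: "f (y (k + 1)) - f v - err \<le> inner g' (w (k + 1) - (v - s *\<^sub>R g v))" for v
    unfolding w err_def A_def g'_def by (rule gradient_step_inequality[OF grad convex lip \<open>L > 0\<close>])
  have "g xmin = 0"
    using grad lip \<open>L > 0\<close> min by (rule gradient_zero_at_minimizer)
  then have step_min: "F' - err \<le> inner g' (w (k + 1) - xmin)"
    using step[of xmin] by (simp add: F'_def)
  have step_prev: "F' - F - err \<le> inner g' (w (k + 1) - w k)"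
    using step[of "y k"] unfolding w[of k] by (simp add: F'_def F_def)
  have "t * (F' - F - err) + (\<alpha> - 1) * (F' - err) \<le> inner g' z'"
    unfolding z'_def rag_z_Suc[OF rag \<open>h \<noteq> 0\<close>] inner_add_right inner_scaleR_right t_def[symmetric]
    using step_min step_prev k \<open>\<alpha> \<ge> 1\<close>
    by (intro add_mono mult_left_mono) (auto simp: t_def)
  then have "n * s * (t * (F' - F - err) + (\<alpha> - 1) * (F' - err)) \<le> n * s * inner g' z'"
    by (intro mult_left_mono) (auto simp: n_def s_def)
  moreover have "(norm z)\<^sup>2 = (norm z')\<^sup>2 + 2 * (n * s * inner g' z') + n\<^sup>2 * s\<^sup>2 * A"
  proof -
    have "z = z' + (n * s) *\<^sub>R g'"
      unfolding z_def z'_def n_def s_def g'_def by (rule rag_z_increment[OF rag \<open>h \<noteq> 0\<close>])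
    then show ?thesis
      unfolding A_def power2_norm_eq_inner
      by (simp add: inner_add_left inner_add_right inner_commute power2_eq_square)
  qed
  moreover have "rag_E \<alpha> h f g xmin y k = s * t * n * F + (norm z)\<^sup>2 / 2"
    by (simp add: rag_E_def s_def t_def n_def F_def z_def)
  moreover have "rag_E \<alpha> h f g xmin y (k + 1) = s * (t + 1) * (n + 1) * F' + (norm z')\<^sup>2 / 2"
    by (simp add: rag_E_def s_def t_def n_def F'_def z'_def algebra_simps)
  \<comment> \<open>The weights satisfy \<open>t + (\<alpha> - 1) = n\<close>: this collects the error terms into \<open>n err\<close> and leaves
    the stated coefficient of \<open>F'\<close>.\<close>
  moreover have "s * t * n * F + n * s * (t * (F' - F - err) + (\<alpha> - 1) * (F' - err))
        + n\<^sup>2 * s\<^sup>2 * A / 2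
      = s * (t + 1) * (n + 1) * F' + s * ((\<alpha> - 3) * real k + 2 * \<alpha> - 5) * F'
        + (1 - s * L) * s\<^sup>2 / 2 * (n\<^sup>2 * A)"
    unfolding t_def n_def err_def by (simp add: power2_eq_square field_simps)
  ultimately have "rag_E \<alpha> h f g xmin y (k + 1)
        + s * ((\<alpha> - 3) * real k + 2 * \<alpha> - 5) * F' + (1 - s * L) * s\<^sup>2 / 2 * (n\<^sup>2 * A)
      \<le> rag_E \<alpha> h f g xmin y k"
    by linarith
  then show ?thesis
    by (simp only: s_def n_def F'_def A_def g'_def)
qed

section \<open>Monotonicity and rates\<close>

lemma antimono_on_nat_upward_closed:
  fixes e :: "nat \<Rightarrow> 'a::preorder"
  assumes step: "\<And>k. k \<in> S \<Longrightarrow> e (Suc k) \<le> e k" and up: "\<And>k. k \<in> S \<Longrightarrow> Suc k \<in> S"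
  shows "antimono_on S e"
proof (rule monotone_onI)
  fix i j :: nat
  assume "i \<in> S" and "i \<le> j"
  from \<open>i \<le> j\<close> have "j \<in> S \<and> e j \<le> e i"
  proof (induction rule: dec_induct)
    case base
    show ?case using \<open>i \<in> S\<close> by simp
  next
    case (step n)
    then show ?case using assms by (meson order_trans)
  qed
  then show "e j \<le> e i" ..
qed

lemma summable_if_dissipated:
  fixes a e :: "nat \<Rightarrow> real"
  assumes a: "\<And>k. k \<ge> N \<Longrightarrow> 0 \<le> a k" and e: "\<And>k. k \<ge> N \<Longrightarrow> 0 \<le> e k"
    and step: "\<And>k. k \<ge> N \<Longrightarrow> e (Suc k) + a k \<le> e k"
  shows "summable a"
proof -
  have "(\<Sum>i<n. a (i + N)) + e (n + N) \<le> e N" for n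
  proof (induction n)
    case (Suc n)
    then show ?case using step[of "n + N"] by simp
  qed simp
  then have "(\<Sum>i<n. a (i + N)) \<le> e N" for n
    using e[of "n + N"] by (smt (verit) le_add2)
  then have "summable (\<lambda>i. a (i + N))"
    using a by (intro summableI_nonneg_bounded) auto
  then show ?thesis
    by (simp add: summable_iff_shift)
qed

theorem theorem5p1:
  fixes f :: "'a::{real_inner, complete_space} \<Rightarrow> real"
    and gradf :: "'a \<Rightarrow> 'a"
    and w y :: "nat \<Rightarrow> 'a"
    and xstar :: 'a
    and L h \<alpha> :: real
  assumes grad: "\<And>x. GDERIV f x :> gradf x"
    and C1: "continuous_on UNIV gradf"
    and convex: "convex_on UNIV f"
    and lipschitz: "L-lipschitz_on UNIV gradf"
    and minimizer: "is_arg_min f (\<lambda>_. True) xstar"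
    and h: "h > 0"
    and \<alpha>: "\<alpha> \<ge> 3"
    and step: "h\<^sup>2 * L < 1"
    and rag: "RAG \<alpha> (h\<^sup>2) gradf w y"
  shows "antimono_on {k. real k + 2 - \<alpha> \<ge> 0} (rag_E \<alpha> h f gradf xstar y)
       \<and> summable (\<lambda>k. (real k)\<^sup>2 * (norm (gradf (y k)))\<^sup>2)
       \<and> (\<alpha> > 3 \<longrightarrow> summable (\<lambda>k. real k * (f (y k) - f xstar)))"
proof -
  let ?E = "rag_E \<alpha> h f gradf xstar y"
  \<comment> \<open>A Lipschitz constant of the gradient that is positive even if \<open>L = 0\<close>, and still below the
    threshold: the midpoint of \<open>L\<close> and \<open>1 / h\<^sup>2\<close>.\<close>
  define K where "K = (L + 1 / h\<^sup>2) / 2"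
  have "L \<ge> 0"
    using lipschitz by (rule lipschitz_on_nonneg)
  moreover have "L < 1 / h\<^sup>2"
    using step h by (simp add: field_simps)
  ultimately have "K > 0" and "L \<le> K" and "K < 1 / h\<^sup>2"
    by (auto simp: K_def)
  then have K: "h\<^sup>2 * K < 1"
    using h by (simp add: field_simps)
  have lip: "K-lipschitz_on UNIV gradf"
    using lipschitz \<open>L \<le> K\<close> by (rule lipschitz_on_le)
  have min: "f xstar \<le> f x" for x
    using minimizer by (auto simp: is_arg_min_def not_less)

  define val where
    "val k = h\<^sup>2 * ((\<alpha> - 3) * real k + 2 * \<alpha> - 5) * (f (y (Suc k)) - f xstar)" for k
  define dis where
    "dis k = (1 - h\<^sup>2 * K) * (h\<^sup>2)\<^sup>2 / 2 * ((real k + 1)\<^sup>2 * (norm (gradf (y (Suc k))))\<^sup>2)" for k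
  have coeff: "(\<alpha> - 3) * (real k + 1) \<le> (\<alpha> - 3) * real k + 2 * \<alpha> - 5" for k
    using \<alpha> by (simp add: algebra_simps)
  then have "0 \<le> (\<alpha> - 3) * real k + 2 * \<alpha> - 5" for k
    using \<alpha> by (intro order_trans[OF _ coeff]) simp
  then have val: "0 \<le> val k" for k
    using min by (simp add: val_def)
  have dis: "0 \<le> dis k" for k
    using K by (simp add: dis_def)
  have decrease: "?E (Suc k) + val k + dis k \<le> ?E k" if "real k + 2 - \<alpha> \<ge> 0" for k
    using rag_E_decrease[OF grad convex lip \<open>K > 0\<close> min rag _ _ that] h \<alpha>
    by (simp add: val_def dis_def)
  have E: "0 \<le> ?E k" if "real k + 2 - \<alpha> \<ge> 0" for k
    using that min by (simp add: rag_E_def)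

  define N where "N = nat \<lceil>\<alpha>\<rceil>"
  have N: "real k + 2 - \<alpha> \<ge> 0" if "k \<ge> N" for k
    using that unfolding N_def by linarith

  have "antimono_on {k. real k + 2 - \<alpha> \<ge> 0} ?E"
  proof (rule antimono_on_nat_upward_closed)
    fix k assume "k \<in> {k. real k + 2 - \<alpha> \<ge> 0}"
    then show "?E (Suc k) \<le> ?E k"
      using decrease[of k] val[of k] dis[of k] by simp
  qed auto
  moreover have "summable (\<lambda>k. (real k)\<^sup>2 * (norm (gradf (y k)))\<^sup>2)"
  proof -
    have "summable dis"
    proof (rule summable_if_dissipated)
      show "?E (Suc k) + dis k \<le> ?E k" if "k \<ge> N" for k
        using decrease[OF N[OF that]] val[of k] by simp
    qed (use E N dis in auto)
    moreover have "(1 - h\<^sup>2 * K) * (h\<^sup>2)\<^sup>2 / 2 \<noteq> 0"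
      using K h by simp
    ultimately have "summable (\<lambda>k. (real (Suc k))\<^sup>2 * (norm (gradf (y (Suc k))))\<^sup>2)"
      unfolding dis_def of_nat_Suc add.commute[of 1] by (rule summable_mult_D)
    then show ?thesis
      by (subst (asm) summable_Suc_iff)
  qed
  moreover have "summable (\<lambda>k. real k * (f (y k) - f xstar))" if "\<alpha> > 3"
  proof -
    define c where "c = h\<^sup>2 * (\<alpha> - 3)"
    have "summable val"
    proof (rule summable_if_dissipated)
      show "?E (Suc k) + val k \<le> ?E k" if "k \<ge> N" for k
        using decrease[OF N[OF that]] dis[of k] by simp
    qed (use E N val in auto)
    moreover have "norm (c * (real (Suc k) * (f (y (Suc k)) - f xstar))) \<le> val k" for k
    proof -
      have "h\<^sup>2 * ((\<alpha> - 3) * (real k + 1)) * (f (y (Suc k)) - f xstar) \<le> val k"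
        unfolding val_def using coeff[of k] min by (intro mult_right_mono mult_left_mono) auto
      then show ?thesis
        using min \<open>\<alpha> > 3\<close> by (simp add: c_def abs_mult mult.assoc add.commute)
    qed
    ultimately have "summable (\<lambda>k. c * (real (Suc k) * (f (y (Suc k)) - f xstar)))"
      by (blast intro: summable_comparison_test)
    moreover have "c \<noteq> 0"
      using h \<open>\<alpha> > 3\<close> by (simp add: c_def)
    ultimately have "summable (\<lambda>k. real (Suc k) * (f (y (Suc k)) - f xstar))"
      by (rule summable_mult_D)
    then show ?thesis
      by (subst (asm) summable_Suc_iff)
  qed
  ultimately show ?thesis
    by blast
qed

end
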